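(* There exists an absolute constant $c>0$ such that the following holds. Let $n$ be a positive integer, let $A \subset \{0,1\}^{n}$ be non-empty, and suppose that \[|\partial A| \leq |A| \log_{2}(2^{n}/|A|) + \epsilon |A|\] for some $0<\epsilon \leq c$. Then \[\frac{|A \Delta C|}{|A|} < 3 \epsilon\] for some subcube $C$ of $\{0,1\}^n$.
   Context: $Q_n$ denotes the $n$-dimensional hypercube graph: its vertex set is $\{0,1\}^n$, and two 0-1 vectors are joined if and only if they differ in exactly one coordinate. For $A \subset \{0,1\}^n$, the edge-boundary $\partial A$ is the set of all edges of $Q_n$ joining a point in $A$ to a point not in $A$. A subcube of $\{0,1\}^n$ is a set of the form $\{x \in \{0,1\}^{n}: x_{i_1}=a_1,\ldots,x_{i_{m}}=a_{m}\}$, where $0 \leq m \leq n$, $i_1<\cdots<i_m$ are coordinates in $[n]=\{1,\ldots,n\}$, and $a_1,\ldots,a_m\in\{0,1\}$ are fixed. $A \Delta C$ denotes the symmetric difference. *)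

theory Defs
  imports Complex_Main "HOL-Library.FuncSet"
begin

text \<open>
  The points of \<open>{0,1}^n\<close> are functions on the coordinates \<open>{1..n}\<close>, made extensional
  (constantly \<open>undefined\<close> outside \<open>{1..n}\<close>) so that each 0-1 vector is represented once.
  The dimension is a number rather than a type, so that it can be quantified after the
  absolute constant.
\<close>

definition cube :: "nat \<Rightarrow> (nat \<Rightarrow> nat) set" where
  "cube n = {1..n} \<rightarrow>\<^sub>E {0, 1}"

text \<open>Edges are unordered pairs, so that each edge is counted once.\<close>

definition cube_edges :: "nat \<Rightarrow> (nat \<Rightarrow> nat) set set" where
  "cube_edges n =
     {{x, y} | x y. x \<in> cube n \<and> y \<in> cube n \<and> card {i \<in> {1..n}. x i \<noteq> y i} = 1}"

definition edge_boundary :: "nat \<Rightarrow> (nat \<Rightarrow> nat) set \<Rightarrow> (nat \<Rightarrow> nat) set set" where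
  "edge_boundary n A = {{x, y} | x y. {x, y} \<in> cube_edges n \<and> x \<in> A \<and> y \<notin> A}"

definition is_subcube :: "nat \<Rightarrow> (nat \<Rightarrow> nat) set \<Rightarrow> bool" where
  "is_subcube n C \<longleftrightarrow>
     (\<exists>I a. I \<subseteq> {1..n} \<and> (\<forall>i\<in>I. a i \<in> {0, 1}) \<and> C = {x \<in> cube n. \<forall>i\<in>I. x i = a i})"

end

theory Submission
  imports Defs "HOL-Analysis.Convex"
begin

text \<open>
  Call \<open>|\<partial>A| - |A| log\<^sub>2 (2\<^sup>n / |A|)\<close> the excess of \<open>A\<close>. Cut the cube in half along a coordinate
  and let \<open>X\<close>, \<open>Y\<close> be the two slices of \<open>A\<close>, regarded as subsets of the cube without that
  coordinate. Counting the edges inside the halves and those across gives the exact identity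
  (\<open>excess_slices\<close>)

    \<open>excess A = excess X + excess Y + |X \<Delta> Y| + h(|X|, |Y|) - |A|\<close>,

  where \<open>h(a, b) = (a + b) log (a + b) - a log a - b log b\<close> is \<open>a + b\<close> times the binary entropy of
  \<open>b / (a + b)\<close>. As \<open>|X \<Delta> Y|\<close> is at least the difference of the sizes and \<open>h(a, b) \<ge> 2 min a b\<close>, the
  last three terms have a nonnegative sum. This yields the edge-isoperimetric inequality
  \<open>excess A \<ge> 0\<close> by induction; it also shows that a set with small excess is, in each direction,
  either almost contained in one half or almost evenly split, since \<open>h(a, b)\<close> is close to
  \<open>2 min a b\<close> only at the two ends.

  Stability, in the form \<open>|A \<Delta> C| \<le> 2 excess A\<close> for some subcube \<open>C\<close> whenever the excess is at most
  \<open>|A| / 100\<close>, follows by induction on the dimension.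

  Suppose first that in some direction the smaller slice \<open>Y\<close> has at most a quarter of the points
  of \<open>A\<close>. Then \<open>h \<ge> 5/2 |Y|\<close>, so passing from \<open>A\<close> to \<open>X\<close> lowers the excess by at least \<open>|Y| / 2\<close>.
  This pays for deleting \<open>Y\<close>: the subcube approximating \<open>X\<close> approximates \<open>A\<close>
  (\<open>stability_step_unbalanced\<close>).

  Suppose now that both slices have more than a quarter of \<open>A\<close> in every direction. Fix one
  direction. One of the two slices has relative excess no larger than that of \<open>A\<close>, so it is close to
  a subcube \<open>C'\<close>; the other slice is close to the first, so \<open>A\<close> is close to the double of \<open>C'\<close>. If
  \<open>C'\<close> fixed some coordinate, then \<open>A\<close> would be almost contained in a half cube, against the
  assumption; so \<open>C'\<close> is everything and \<open>A\<close> misses only a small part of the cube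
  (\<open>stability_step_balanced\<close>). The error from this step is larger than what is being proved. But a
  set with a small complement \<open>B\<close> has the boundary of \<open>B\<close>, and the isoperimetric inequality for
  \<open>B\<close> then bounds \<open>|B|\<close> by the excess of \<open>A\<close> itself (\<open>card_complement_le_excess\<close>), so that errors do
  not accumulate along the induction.
\<close>

section \<open>Slices and the directed form of the edge boundary\<close>

text \<open>
  The induction removes an arbitrary coordinate, so cubes are indexed by arbitrary sets of
  coordinates.
\<close>

abbreviation vertices :: "'a set \<Rightarrow> ('a \<Rightarrow> nat) set" where
  "vertices S \<equiv> S \<rightarrow>\<^sub>E {0, 1}"

definition flip :: "'a \<Rightarrow> ('a \<Rightarrow> nat) \<Rightarrow> 'a \<Rightarrow> nat" where
  "flip i x = x(i := 1 - x i)"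

text \<open>
  Erasing coordinate \<open>i\<close> means resetting it to \<open>undefined\<close>, so that the slices of a subset of
  \<open>vertices S\<close> are extensional functions on \<open>S - {i}\<close>.
\<close>

definition slice :: "'a \<Rightarrow> nat \<Rightarrow> ('a \<Rightarrow> nat) set \<Rightarrow> ('a \<Rightarrow> nat) set" where
  "slice i b X = {y. y i = undefined \<and> y(i := b) \<in> X}"

text \<open>
  Each boundary edge is counted through its unique endpoint in \<open>A\<close>, separately in each direction.
\<close>

definition boundary_size :: "'a set \<Rightarrow> ('a \<Rightarrow> nat) set \<Rightarrow> nat" where
  "boundary_size S A = (\<Sum>i\<in>S. card {x \<in> A. flip i x \<notin> A})"

lemma finite_vertices: "finite S \<Longrightarrow> finite (vertices S)"
  by (intro finite_PiE) auto

lemma card_vertices: "finite S \<Longrightarrow> card (vertices S) = 2 ^ card S"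
  by (simp add: card_PiE numeral_2_eq_2)

lemma finite_sub_vertices: "finite S \<Longrightarrow> X \<subseteq> vertices S \<Longrightarrow> finite X"
  using finite_vertices finite_subset by blast

lemma vertices_coord: "x \<in> vertices S \<Longrightarrow> i \<in> S \<Longrightarrow> x i = 0 \<or> x i = 1"
  by (auto dest: PiE_mem)

lemma flip_in_vertices: "x \<in> vertices S \<Longrightarrow> i \<in> S \<Longrightarrow> flip i x \<in> vertices S"
  using vertices_coord[of x S i] by (auto simp: flip_def PiE_iff extensional_def)

lemma flip_flip: "x \<in> vertices S \<Longrightarrow> i \<in> S \<Longrightarrow> flip i (flip i x) = x"
  using vertices_coord[of x S i] by (auto simp: flip_def)

lemma slice_subset:
  assumes "X \<subseteq> vertices S" "i \<in> S"
  shows "slice i b X \<subseteq> vertices (S - {i})"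
proof
  fix y assume "y \<in> slice i b X"
  then have y: "y i = undefined" "y(i := b) \<in> vertices S" using assms(1) unfolding slice_def by blast+
  have "y k \<in> {0, 1}" if "k \<in> S - {i}" for k
    using PiE_mem[OF y(2), of k] that by auto
  moreover have "y k = undefined" if "k \<notin> S - {i}" for k
    using PiE_arb[OF y(2), of k] that y(1) assms(2) by (cases "k = i") auto
  ultimately show "y \<in> vertices (S - {i})"
    by (auto simp: PiE_iff extensional_def)
qed

lemma finite_slice:
  assumes "finite S" "X \<subseteq> vertices S" "i \<in> S"
  shows "finite (slice i b X)"
  using finite_sub_vertices[OF finite_Diff[OF assms(1)] slice_subset[OF assms(2,3)]] .

lemma inj_on_slice_embedding: "inj_on (\<lambda>y. y(i := b)) (slice i b X)"
  by (rule inj_on_inverseI[where g = "\<lambda>x. x(i := undefined)"]) (simp add: slice_def fun_upd_idem)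

lemma card_slice: "card (slice i b X) = card {x \<in> X. x i = b}"
proof -
  have "(\<lambda>y. y(i := b)) ` slice i b X = {x \<in> X. x i = b}"
  proof (intro set_eqI iffI)
    fix x assume "x \<in> {x \<in> X. x i = b}"
    then have "x(i := undefined) \<in> slice i b X" "x = (x(i := undefined))(i := b)"
      by (auto simp: slice_def)
    then show "x \<in> (\<lambda>y. y(i := b)) ` slice i b X" by blast
  qed (auto simp: slice_def)
  then show ?thesis using card_image[OF inj_on_slice_embedding] by metis
qed

lemma card_slices:
  assumes "finite S" "X \<subseteq> vertices S" "i \<in> S" "b = 0 \<or> b = 1"
  shows "card X = card (slice i b X) + card (slice i (1 - b) X)"
proof -
  have "x i = b \<or> x i = 1 - b" if "x \<in> X" for x
    using vertices_coord[of x S i] that assms(2-4) by auto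
  then have "X = {x \<in> X. x i = b} \<union> {x \<in> X. x i = 1 - b}" by blast
  moreover have "card ({x \<in> X. x i = b} \<union> {x \<in> X. x i = 1 - b})
      = card {x \<in> X. x i = b} + card {x \<in> X. x i = 1 - b}"
    using assms finite_sub_vertices[of S X] by (intro card_Un_disjoint) auto
  ultimately show ?thesis by (simp add: card_slice)
qed

lemma slice_diff: "slice i b (X - Y) = slice i b X - slice i b Y"
  by (auto simp: slice_def)

lemma slice_Un: "slice i b (X \<union> Y) = slice i b X \<union> slice i b Y"
  by (auto simp: slice_def)

lemma card_sym_diff_slices:
  assumes "finite S" "X \<subseteq> vertices S" "Y \<subseteq> vertices S" "i \<in> S" "b = 0 \<or> b = 1"
  shows "card (sym_diff X Y) = card (sym_diff (slice i b X) (slice i b Y))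
    + card (sym_diff (slice i (1 - b) X) (slice i (1 - b) Y))"
proof -
  have "sym_diff X Y \<subseteq> vertices S" using assms(2,3) by blast
  from card_slices[OF assms(1) this assms(4,5)] show ?thesis by (simp only: slice_diff slice_Un)
qed

text \<open>
  Slicing along \<open>i\<close> commutes with flipping any other coordinate, so edges in the other directions
  stay inside one of the two halves; an edge in direction \<open>i\<close> is in the boundary exactly when
  its two ends lie over a point of the symmetric difference of the slices.
\<close>

lemma boundary_size_slices:
  assumes "finite S" "A \<subseteq> vertices S" "i \<in> S" "b = 0 \<or> b = 1"
  shows "boundary_size S A = boundary_size (S - {i}) (slice i b A)
    + boundary_size (S - {i}) (slice i (1 - b) A)
    + card (sym_diff (slice i b A) (slice i (1 - b) A))"
proof -
  note fin = finite_slice[OF assms(1-3)]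
  have split: "card {x \<in> A. flip j x \<notin> A} = card (slice i b {x \<in> A. flip j x \<notin> A})
      + card (slice i (1 - b) {x \<in> A. flip j x \<notin> A})" for j
    by (rule card_slices[OF assms(1) _ assms(3,4)]) (use assms(2) in blast)
  have same: "slice i c {x \<in> A. flip i x \<notin> A} = slice i c A - slice i (1 - c) A" for c
    by (auto simp: slice_def flip_def)
  have other: "slice i c {x \<in> A. flip j x \<notin> A} = {y \<in> slice i c A. flip j y \<notin> slice i c A}"
    if "j \<noteq> i" for c j
    using that by (auto simp: slice_def flip_def fun_upd_twist)
  have "card {x \<in> A. flip i x \<notin> A} = card (slice i b A - slice i (1 - b) A)
      + card (slice i (1 - b) A - slice i b A)"
    using split[of i] assms(4) by (auto simp: same)
  also have "\<dots> = card (sym_diff (slice i b A) (slice i (1 - b) A))"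
    using fin by (subst card_Un_disjoint) auto
  finally have i: "card {x \<in> A. flip i x \<notin> A}
      = card (sym_diff (slice i b A) (slice i (1 - b) A))" .
  have "boundary_size S A
      = card {x \<in> A. flip i x \<notin> A} + (\<Sum>j\<in>S - {i}. card {x \<in> A. flip j x \<notin> A})"
    unfolding boundary_size_def using assms by (intro sum.remove) auto
  also have "(\<Sum>j\<in>S - {i}. card {x \<in> A. flip j x \<notin> A}) =
      boundary_size (S - {i}) (slice i b A) + boundary_size (S - {i}) (slice i (1 - b) A)"
    unfolding boundary_size_def sum.distrib[symmetric]
    by (intro sum.cong refl) (subst split, auto simp: other)
  finally show ?thesis using i by simp
qed

lemma boundary_size_complement:
  assumes "finite S" "A \<subseteq> vertices S"
  shows "boundary_size S (vertices S - A) = boundary_size S A"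
  unfolding boundary_size_def
proof (rule sum.cong[OF refl])
  fix i assume i: "i \<in> S"
  have "bij_betw (flip i) {x \<in> vertices S - A. flip i x \<notin> vertices S - A} {x \<in> A. flip i x \<notin> A}"
  proof (rule bij_betw_byWitness[where f' = "flip i"])
    have V: "flip i x \<in> vertices S" "flip i (flip i x) = x" if "x \<in> vertices S" for x
      using that i by (rule flip_in_vertices, rule flip_flip)
    show "\<forall>x\<in>{x \<in> vertices S - A. flip i x \<notin> vertices S - A}. flip i (flip i x) = x"
      using V(2) by blast
    show "\<forall>x\<in>{x \<in> A. flip i x \<notin> A}. flip i (flip i x) = x"
      using V(2) assms(2) by blast
    show "flip i ` {x \<in> vertices S - A. flip i x \<notin> vertices S - A} \<subseteq> {x \<in> A. flip i x \<notin> A}"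
      using V by (intro image_subsetI) simp
    show "flip i ` {x \<in> A. flip i x \<notin> A} \<subseteq> {x \<in> vertices S - A. flip i x \<notin> vertices S - A}"
      using V subsetD[OF assms(2)] by (intro image_subsetI) simp
  qed
  then show "card {x \<in> vertices S - A. flip i x \<notin> vertices S - A} = card {x \<in> A. flip i x \<notin> A}"
    by (rule bij_betw_same_card)
qed

text \<open>
  The pair \<open>(i, x)\<close> can be read off the edge \<open>{x, flip i x}\<close>: \<open>x\<close> is its endpoint in \<open>A\<close>, and \<open>i\<close> is
  the coordinate in which the two ends differ.
\<close>

lemma card_edge_boundary:
  assumes A: "A \<subseteq> cube n"
  shows "card (edge_boundary n A) = boundary_size {1..n} A"
proof -
  define P where "P = (SIGMA i:{1..n}. {x \<in> A. flip i x \<notin> A})"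
  have fin: "finite A" using A finite_sub_vertices[of "{1..n}" A] by (simp add: cube_def)
  have diff: "{k \<in> {1..n}. x k \<noteq> flip i x k} = {i}" if "x \<in> A" "i \<in> {1..n}" for x i
  proof -
    have "x i = 0 \<or> x i = 1" using that A vertices_coord[of x "{1..n}" i] unfolding cube_def by blast
    then show ?thesis using that(2) by (auto simp: flip_def)
  qed
  have inj: "inj_on (\<lambda>(i, x). {x, flip i x}) P"
  proof (rule inj_onI, clarify)
    fix i x j y assume p: "(i, x) \<in> P" "(j, y) \<in> P" "{x, flip i x} = {y, flip j y}"
    have mem: "x \<in> A" "y \<in> A" "i \<in> {1..n}" "j \<in> {1..n}" "flip i x \<notin> A" "flip j y \<notin> A"
      using p(1,2) by (simp_all add: P_def)
    have "x = y" "flip i x = flip j y"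
      using p(3) mem unfolding doubleton_eq_iff by blast+
    then have "{i} = {j}" using diff[OF mem(1,3)] diff[OF mem(2,4)] by metis
    then show "i = j \<and> x = y" using \<open>x = y\<close> by simp
  qed
  have "(\<lambda>(i, x). {x, flip i x}) ` P = edge_boundary n A"
  proof (intro set_eqI iffI)
    fix e assume "e \<in> (\<lambda>(i, x). {x, flip i x}) ` P"
    then obtain i x where e: "e = {x, flip i x}" "i \<in> {1..n}" "x \<in> A" "flip i x \<notin> A"
      by (auto simp: P_def)
    have "x \<in> cube n" using e(3) A by blast
    moreover have "flip i x \<in> cube n"
      using flip_in_vertices[of x "{1..n}" i] \<open>x \<in> cube n\<close> e(2) unfolding cube_def by blast
    moreover have "card {k \<in> {1..n}. x k \<noteq> flip i x k} = 1" using diff[OF e(3,2)] by simp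
    ultimately have "{x, flip i x} \<in> cube_edges n" unfolding cube_edges_def by blast
    then show "e \<in> edge_boundary n A" using e(1,3,4) unfolding edge_boundary_def by blast
  next
    fix e assume "e \<in> edge_boundary n A"
    then obtain x y where e: "e = {x, y}" "{x, y} \<in> cube_edges n" "x \<in> A" "y \<notin> A"
      by (auto simp: edge_boundary_def)
    obtain u v where uv: "{x, y} = {u, v}" "u \<in> cube n" "v \<in> cube n"
      "card {i \<in> {1..n}. u i \<noteq> v i} = 1"
      using e(2) unfolding cube_edges_def by blast
    have sym: "{i \<in> {1..n}. v i \<noteq> u i} = {i \<in> {1..n}. u i \<noteq> v i}" by (simp only: eq_commute)
    have "x = u \<and> y = v \<or> x = v \<and> y = u" using uv(1) unfolding doubleton_eq_iff .
    then have xy: "x \<in> cube n" "y \<in> cube n" "card {i \<in> {1..n}. x i \<noteq> y i} = 1"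
      using uv(2-4) sym by force+
    then obtain i where i: "{i \<in> {1..n}. x i \<noteq> y i} = {i}" by (metis card_1_singletonE)
    then have "i \<in> {1..n}" "x i \<noteq> y i" and eq: "\<And>k. k \<in> {1..n} \<Longrightarrow> k \<noteq> i \<Longrightarrow> x k = y k"
      by blast+
    moreover have "x k = y k" if "k \<notin> {1..n}" for k
      using that \<open>x \<in> cube n\<close> \<open>y \<in> cube n\<close> unfolding cube_def by (metis PiE_arb)
    ultimately have off: "y k = x k" if "k \<noteq> i" for k using that by metis
    have "x i = 0 \<or> x i = 1" "y i = 0 \<or> y i = 1"
      using vertices_coord[of _ "{1..n}" i] \<open>x \<in> cube n\<close> \<open>y \<in> cube n\<close> \<open>i \<in> {1..n}\<close>
      unfolding cube_def by blast+
    then have "y i = 1 - x i" using \<open>x i \<noteq> y i\<close> by auto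
    then have "y = flip i x" using off by (auto simp: flip_def fun_eq_iff)
    then show "e \<in> (\<lambda>(i, x). {x, flip i x}) ` P"
      using e(1,3,4) \<open>i \<in> {1..n}\<close> by (intro image_eqI[of _ _ "(i, x)"]) (simp_all add: P_def)
  qed
  then have "card (edge_boundary n A) = card P" using card_image[OF inj] by simp
  also have "\<dots> = boundary_size {1..n} A"
    unfolding P_def boundary_size_def by (rule card_SigmaI) (use fin in simp_all)
  finally show ?thesis .
qed

section \<open>Two chords below the binary entropy function\<close>

text \<open>
  This is \<open>(a + b) H(b / (a + b))\<close> for the binary entropy \<open>H\<close>. The value is correct for \<open>a = 0\<close> or
  \<open>b = 0\<close> as well, because \<open>0 * log 2 0 = 0\<close>.
\<close>

definition split_entropy :: "real \<Rightarrow> real \<Rightarrow> real" where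
  "split_entropy a b = (a + b) * log 2 (a + b) - a * log 2 a - b * log 2 b"

lemma split_entropy_commute: "split_entropy a b = split_entropy b a"
  by (simp add: split_entropy_def add.commute)

text \<open>
  With \<open>q = b / (a + b) \<le> 1/4\<close>, the term \<open>q log (1/q)\<close> of the entropy is at least \<open>2 q\<close>, and
  \<open>(1 - q) log (1/(1 - q)) \<ge> (1 - q) q \<ge> q / 2\<close>. The surplus over \<open>2 b\<close> is what pays for deleting
  the smaller slice in the stability proof.
\<close>

lemma split_entropy_unbalanced:
  assumes "0 \<le> b" "4 * b \<le> a + b"
  shows "split_entropy a b \<ge> 5 / 2 * b"
proof (cases "b = 0")
  case True
  then show ?thesis by (simp add: split_entropy_def)
next
  case False
  then have pos: "a > 0" "b > 0" using assms by auto
  have "2 = log 2 (4::real)" using log_nat_power[of 2 2 2] by simp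
  also have "\<dots> \<le> log 2 ((a + b) / b)" using pos assms by (simp add: field_simps)
  finally have b: "2 * b \<le> b * log 2 ((a + b) / b)" using pos by (simp add: mult.commute)
  have "ln (a / (a + b)) \<le> a / (a + b) - 1" using pos by (intro ln_le_minus_one) simp
  then have "ln ((a + b) / a) \<ge> b / (a + b)"
    using pos by (simp add: ln_div field_simps)
  moreover have "ln ((a + b) / a) \<le> log 2 ((a + b) / a)"
  proof -
    have "ln 2 \<le> (1::real)" using ln_le_minus_one[of "2::real"] by simp
    moreover have "ln ((a + b) / a) \<ge> 0" using pos by simp
    ultimately show ?thesis
      unfolding log_def using mult_left_le[of "ln (2::real)" "ln ((a + b) / a)"]
      by (simp add: le_divide_eq)
  qed
  ultimately have "a * (b / (a + b)) \<le> a * log 2 ((a + b) / a)" using pos by (intro mult_left_mono) auto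
  moreover have "b / 2 \<le> a * (b / (a + b))" using pos assms by (simp add: field_simps)
  ultimately have "5 / 2 * b \<le> a * log 2 ((a + b) / a) + b * log 2 ((a + b) / b)" using b by linarith
  also have "\<dots> = split_entropy a b"
    using pos by (simp add: split_entropy_def log_divide algebra_simps)
  finally show ?thesis .
qed

lemma concave_binary_entropy:
  "concave_on {1/4..1/2} (\<lambda>q::real. - (q * ln q) - (1 - q) * ln (1 - q))"
proof (rule f''_le0_imp_concave)
  fix x :: real assume x: "x \<in> {1/4..1/2}"
  show "((\<lambda>q. - (q * ln q) - (1 - q) * ln (1 - q)) has_real_derivative (ln (1 - x) - ln x)) (at x)"
    using x by (auto intro!: derivative_eq_intros)
  show "((\<lambda>q. ln (1 - q) - ln q) has_real_derivative (- (1 / (1 - x)) - 1 / x)) (at x)"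
    using x by (auto intro!: derivative_eq_intros)
  have "1 / (1 - x) \<ge> 0" "1 / x \<ge> 0" using x by simp_all
  then show "- (1 / (1 - x)) - 1 / x \<le> 0" by linarith
qed simp

text \<open>
  On \<open>[1/4, 1/2]\<close> the concave entropy \<open>H q\<close> lies above the line \<open>q + 1/2\<close>, because it does so at both
  ends. At \<open>q = 1/2\<close> there is equality with \<open>2 q\<close>, and the distance from \<open>2 q\<close> grows linearly as \<open>q\<close>
  moves away from \<open>1/2\<close>: small excess forces a nearly even split.
\<close>

lemma split_entropy_balanced:
  assumes "b \<le> a" "a + b \<le> 4 * b" "0 < b"
  shows "split_entropy a b \<ge> b + (a + b) / 2"
proof -
  define f where "f = (\<lambda>q::real. - (q * ln q) - (1 - q) * ln (1 - q))"
  define s q where "s = a + b" and "q = b / s"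
  have s: "s > 0" "b = s * q" "a = s * (1 - q)" and q: "1/4 \<le> q" "q \<le> 1/2"
    using assms by (auto simp: s_def q_def field_simps)
  have chord: "(f (1/2) - f (1/4)) / (1/2 - 1/4) * (q - 1/4) + f (1/4) \<le> f q"
    using concave_binary_entropy[folded f_def] q
    by (intro concave_onD_Icc') (auto simp: f_def)
  have ln4: "ln (4::real) = 2 * ln 2" using ln_realpow[of 2 2] by simp
  have half: "f (1/2) = ln 2" by (simp add: f_def ln_div)
  \<comment> \<open>The chord has to lie above \<open>q + 1/2\<close> at \<open>q = 1/4\<close>; this is \<open>3^3 \<le> 2^5\<close>.\<close>
  have "ln (27::real) \<le> ln 32" by simp
  moreover have "ln (27::real) = 3 * ln 3" "ln (32::real) = 5 * ln 2"
    using ln_realpow[of 3 3] ln_realpow[of 2 5] by simp_all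
  ultimately have "3 * ln (3::real) \<le> 5 * ln 2" by linarith
  then have quarter: "f (1/4) \<ge> 3 / 4 * ln 2"
    by (simp add: f_def ln_div ln4 field_simps)
  have "(f (1/2) - f (1/4)) / (1/2 - 1/4) * (q - 1/4) + f (1/4)
      = (4 * q - 1) * f (1/2) + (2 - 4 * q) * f (1/4)" by (simp add: field_simps)
  then have "(4 * q - 1) * ln 2 + (2 - 4 * q) * (3 / 4 * ln 2) \<le> f q"
    using chord half mult_left_mono[OF quarter, of "2 - 4 * q"] q by simp
  moreover have "(4 * q - 1) * ln 2 + (2 - 4 * q) * (3 / 4 * ln 2) = (q + 1/2) * ln (2::real)"
    by (simp add: field_simps)
  ultimately have "(q + 1/2) * ln 2 \<le> f q" by linarith
  then have "q + 1/2 \<le> f q / ln 2" by (simp add: field_simps)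
  then have "s * (q + 1/2) \<le> s * (f q / ln 2)" using s by (intro mult_left_mono) auto
  moreover have "s * (f q / ln 2) = split_entropy a b"
  proof -
    have "ln (s * q) = ln s + ln q" "ln (s * (1 - q)) = ln s + ln (1 - q)"
      using s(1) q by (auto simp: ln_mult)
    moreover have "split_entropy a b
        = s * log 2 s - (s * (1 - q)) * log 2 (s * (1 - q)) - (s * q) * log 2 (s * q)"
      unfolding split_entropy_def s_def[symmetric] s(2,3)[symmetric] ..
    moreover have "(s * ln s - s * (1 - q) * (ln s + ln (1 - q)) - s * q * (ln s + ln q)) = s * f q"
      by (simp add: f_def algebra_simps)
    ultimately show ?thesis by (simp add: log_def flip: diff_divide_distrib)
  qed
  moreover have "s * (q + 1/2) = b + (a + b) / 2"
    by (simp add: distrib_left s(2)[symmetric] s_def[symmetric])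
  ultimately show ?thesis by simp
qed

lemma split_entropy_ge_twice_min:
  assumes "0 \<le> b" "b \<le> a"
  shows "split_entropy a b \<ge> 2 * b"
proof (cases "4 * b \<le> a + b")
  case True
  then show ?thesis using split_entropy_unbalanced[of b a] assms by simp
next
  case False
  then show ?thesis using split_entropy_balanced[of b a] assms by argo
qed

section \<open>The excess over the edge-isoperimetric bound\<close>

definition excess :: "'a set \<Rightarrow> ('a \<Rightarrow> nat) set \<Rightarrow> real" where
  "excess S A = real (boundary_size S A) - real (card A) * log 2 (2 ^ card S / real (card A))"

lemma excess_expand:
  "excess S A = real (boundary_size S A) - real (card A) * real (card S)
    + real (card A) * log 2 (real (card A))"
  by (cases "card A = 0") (auto simp: excess_def log_divide log_nat_power algebra_simps)

lemma excess_slices: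
  assumes "finite S" "A \<subseteq> vertices S" "i \<in> S" "b = 0 \<or> b = 1"
  shows "excess S A = excess (S - {i}) (slice i b A) + excess (S - {i}) (slice i (1 - b) A)
    + real (card (sym_diff (slice i b A) (slice i (1 - b) A)))
    + split_entropy (card (slice i b A)) (card (slice i (1 - b) A)) - real (card A)"
proof -
  have "card S = Suc (card (S - {i}))" using assms card_gt_0_iff[of S] by auto
  then show ?thesis
    using card_slices[OF assms] boundary_size_slices[OF assms]
    by (simp add: excess_expand split_entropy_def algebra_simps)
qed

lemma card_diff_le_sym_diff:
  assumes "finite X" "finite Y"
  shows "real (card X) - real (card Y) \<le> real (card (sym_diff X Y))"
proof -
  have "card X \<le> card (Y \<union> sym_diff X Y)" using assms by (intro card_mono) auto
  also have "\<dots> \<le> card Y + card (sym_diff X Y)" by (rule card_Un_le)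
  finally show ?thesis by linarith
qed

text \<open>
  The contribution of one direction to the excess is nonnegative: if \<open>b \<le> a\<close> are the two sizes, then
  the left side is at least \<open>(a - b) + 2 b\<close>.
\<close>

lemma sym_diff_split_entropy:
  assumes "finite X" "finite Y"
  shows "real (card (sym_diff X Y)) + split_entropy (card X) (card Y)
    \<ge> real (card X) + real (card Y)"
proof (cases "card Y \<le> card X")
  case True
  then show ?thesis
    using card_diff_le_sym_diff[OF assms] split_entropy_ge_twice_min[of "card Y" "card X"] by simp
next
  case False
  then show ?thesis
    using card_diff_le_sym_diff[OF assms(2,1)] split_entropy_ge_twice_min[of "card X" "card Y"]
    by (simp add: split_entropy_commute Un_commute)
qed

theorem edge_isoperimetric_inequality:
  assumes "finite S" "A \<subseteq> vertices S"
  shows "excess S A \<ge> 0"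
  using assms
proof (induction S arbitrary: A rule: finite_induct)
  case empty
  have "card A \<le> 1" using empty card_mono[of "{\<lambda>_. undefined}" A] by simp
  then have "card A = 0 \<or> card A = 1" by linarith
  then show ?case by (auto simp: excess_def)
next
  case (insert i S)
  have sub: "slice i c A \<subseteq> vertices S" for c
    using slice_subset[OF insert.prems, of i c] insert.hyps by simp
  then have fin: "finite (slice i c A)" for c using finite_sub_vertices[OF insert.hyps(1)] by blast
  show ?case
    using excess_slices[of "insert i S" A i 0] card_slices[of "insert i S" A i 0]
      insert.IH[OF sub[of 0]] insert.IH[OF sub[of 1]]
      sym_diff_split_entropy[OF fin[of 0] fin[of 1]] insert.hyps insert.prems
    by simp
qed

lemma excess_slice_nonneg:
  assumes "finite S" "A \<subseteq> vertices S" "i \<in> S"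
  shows "excess (S - {i}) (slice i b A) \<ge> 0"
  using edge_isoperimetric_inequality[OF finite_Diff[OF assms(1)] slice_subset[OF assms(2,3)]] .

text \<open>
  \<open>A\<close> and its complement \<open>B\<close> have the same boundary, of size at least \<open>|B| log (2\<^sup>n / |B|) \<ge> 3 |B|\<close>,
  while \<open>|A| log (2\<^sup>n / |A|)\<close> is at most \<open>|B| / ln 2 \<le> 2 |B|\<close>.
\<close>

lemma card_complement_le_excess:
  assumes "finite S" "A \<subseteq> vertices S" "8 * card (vertices S - A) \<le> 2 ^ card S"
  shows "real (card (vertices S - A)) \<le> excess S A"
proof (cases "card (vertices S - A) = 0")
  case True
  then show ?thesis using edge_isoperimetric_inequality assms by auto
next
  case False
  define \<beta> s N where "\<beta> = real (card (vertices S - A))" and "s = real (card A)"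
    and "N = (2::real) ^ card S"
  have "card (vertices S) = card A + card (vertices S - A)"
    using assms card_Un_disjoint[of A "vertices S - A"] finite_vertices[OF assms(1)]
      finite_sub_vertices[OF assms(1,2)] by (simp add: Un_absorb1)
  then have "real (2 ^ card S) = real (card A + card (vertices S - A))"
    using card_vertices[OF assms(1)] by metis
  then have N: "N = s + \<beta>" by (simp add: N_def s_def \<beta>_def)
  have "8 * \<beta> \<le> N" 
  proof -
    have "real (8 * card (vertices S - A)) \<le> real (2 ^ card S)" using assms(3) by (rule of_nat_mono)
    then show ?thesis by (simp add: \<beta>_def N_def)
  qed
  have pos: "\<beta> > 0" "s > 0" using False N \<open>8 * \<beta> \<le> N\<close> by (auto simp: \<beta>_def)
  have "3 = log 2 (8::real)" using log_nat_power[of 2 2 3] by simp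
  also have "\<dots> \<le> log 2 (N / \<beta>)" using \<open>8 * \<beta> \<le> N\<close> pos by (simp add: field_simps)
  finally have "3 * \<beta> \<le> \<beta> * log 2 (N / \<beta>)" using pos by simp
  moreover have "s * log 2 (N / s) \<le> 2 * \<beta>"
  proof -
    have "s * ln (N / s) \<le> s * (N / s - 1)"
      using pos N by (intro mult_left_mono ln_le_minus_one) auto
    also have "\<dots> = \<beta>" using pos N by (simp add: field_simps)
    also have "\<beta> \<le> 2 * \<beta> * ln 2"
    proof -
      have "1 / 2 \<le> ln (2::real)" using ln_le_minus_one[of "1 / 2 :: real"] by (simp add: ln_div)
      then show ?thesis using mult_left_mono[of "1/2" "ln 2" "2 * \<beta>"] pos by simp
    qed
    finally show ?thesis by (simp add: log_def field_simps)
  qed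
  moreover have "excess S (vertices S - A) \<ge> 0"
    using assms by (intro edge_isoperimetric_inequality) auto
  moreover have "excess S (vertices S - A) = real (boundary_size S A) - \<beta> * log 2 (N / \<beta>)"
    unfolding excess_def \<beta>_def N_def boundary_size_complement[OF assms(1,2)] ..
  moreover have "excess S A = real (boundary_size S A) - s * log 2 (N / s)"
    unfolding excess_def s_def N_def ..
  ultimately show ?thesis unfolding \<beta>_def[symmetric] by linarith
qed

section \<open>Stability\<close>

definition subcube :: "'a set \<Rightarrow> ('a \<Rightarrow> nat) set \<Rightarrow> bool" where
  "subcube S C \<longleftrightarrow>
     (\<exists>I a. I \<subseteq> S \<and> (\<forall>i\<in>I. a i \<in> {0, 1}) \<and> C = {x \<in> vertices S. \<forall>i\<in>I. x i = a i})"

lemma upd_in_vertices: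
  assumes "i \<in> S" "y \<in> vertices (S - {i})" "c = 0 \<or> c = 1"
  shows "y(i := c) \<in> vertices S"
  using assms by (auto simp: PiE_iff extensional_def)

lemma slice_filter_vertices:
  assumes "i \<in> S" "c = 0 \<or> c = 1"
  shows "slice i c {x \<in> vertices S. P x} = {y \<in> vertices (S - {i}). P (y(i := c))}"
proof
  show "slice i c {x \<in> vertices S. P x} \<subseteq> {y \<in> vertices (S - {i}). P (y(i := c))}"
  proof
    fix y assume y: "y \<in> slice i c {x \<in> vertices S. P x}"
    then have "y \<in> vertices (S - {i})"
      using slice_subset[of "{x \<in> vertices S. P x}" S i c] assms(1) by blast
    then show "y \<in> {y \<in> vertices (S - {i}). P (y(i := c))}" using y by (simp add: slice_def)
  qed
  show "{y \<in> vertices (S - {i}). P (y(i := c))} \<subseteq> slice i c {x \<in> vertices S. P x}"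
  proof
    fix y assume y: "y \<in> {y \<in> vertices (S - {i}). P (y(i := c))}"
    then have "y(i := c) \<in> vertices S" "y i = undefined"
      using upd_in_vertices[OF assms(1) _ assms(2), of y] PiE_arb[of y "S - {i}" _ i] by auto
    then show "y \<in> slice i c {x \<in> vertices S. P x}" using y by (simp add: slice_def)
  qed
qed

lemma subcube_lift_fixed:
  assumes "i \<in> S" "b = 0 \<or> b = 1" "subcube (S - {i}) C'"
  obtains C where "subcube S C" "slice i b C = C'" "slice i (1 - b) C = {}"
proof -
  obtain I a where C': "I \<subseteq> S - {i}" "\<forall>k\<in>I. a k \<in> {0, 1}"
    "C' = {x \<in> vertices (S - {i}). \<forall>k\<in>I. x k = a k}" using assms(3) unfolding subcube_def by blast
  have b: "1 - b = 0 \<or> 1 - b = 1" "1 - b \<noteq> b" using assms(2) by auto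
  have "i \<notin> I" using C'(1) by blast
  then have off: "(\<forall>k\<in>I. (y(i := c)) k = (a(i := b)) k) \<longleftrightarrow> (\<forall>k\<in>I. y k = a k)" for y c
    by (intro ball_cong) auto
  define C where "C = {x \<in> vertices S. \<forall>k\<in>insert i I. x k = (a(i := b)) k}"
  have "subcube S C" unfolding subcube_def
  proof (intro exI conjI)
    show "insert i I \<subseteq> S" using assms(1) C'(1) by blast
    show "\<forall>k\<in>insert i I. (a(i := b)) k \<in> {0, 1}" using assms(2) C'(2) by simp
  qed (rule C_def)
  moreover have "slice i (1 - b) C = {}"
    unfolding C_def slice_filter_vertices[OF assms(1) b(1)] using b(2) by simp
  moreover have "slice i b C = C'"
    unfolding C_def slice_filter_vertices[OF assms(1,2)] C'(3) ball_simps off by simp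
  ultimately show ?thesis using that by blast
qed

lemma subcube_lift_free:
  assumes "i \<in> S" "I \<subseteq> S - {i}" "c = 0 \<or> c = 1"
  shows "slice i c {x \<in> vertices S. \<forall>k\<in>I. x k = a k} = {x \<in> vertices (S - {i}). \<forall>k\<in>I. x k = a k}"
proof -
  have "(\<forall>k\<in>I. (y(i := c)) k = a k) \<longleftrightarrow> (\<forall>k\<in>I. y k = a k)" for y
    using assms(2) by (intro ball_cong) auto
  then show ?thesis unfolding slice_filter_vertices[OF assms(1,3)] by simp
qed

lemma card_sym_diff_triangle:
  assumes "finite X" "finite Y" "finite Z"
  shows "card (sym_diff X Z) \<le> card (sym_diff X Y) + card (sym_diff Y Z)"
proof -
  have "card (sym_diff X Z) \<le> card (sym_diff X Y \<union> sym_diff Y Z)"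
    using assms by (intro card_mono) auto
  also have "\<dots> \<le> card (sym_diff X Y) + card (sym_diff Y Z)" by (rule card_Un_le)
  finally show ?thesis .
qed

lemma subcube_vertices: "subcube S (vertices S)"
  unfolding subcube_def by (rule exI[of _ "{}"]) simp

text \<open>
  The larger slice \<open>X\<close> satisfies \<open>excess X + |Y| / 2 \<le> excess A\<close>. So its relative excess is again at
  most \<open>1/100\<close>, and \<open>2 excess X + |Y| \<le> 2 excess A\<close>: the bound for \<open>X\<close> absorbs the points of \<open>Y\<close>.
\<close>

lemma stability_step_unbalanced:
  assumes S: "finite S" "A \<subseteq> vertices S" "i \<in> S" "b = 0 \<or> b = 1" and "A \<noteq> {}"
    and small: "100 * excess S A \<le> card A"
    and thin: "4 * card (slice i (1 - b) A) \<le> card A"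
    and IH: "slice i b A \<noteq> {} \<Longrightarrow> 100 * excess (S - {i}) (slice i b A) \<le> card (slice i b A) \<Longrightarrow>
      \<exists>C. subcube (S - {i}) C \<and> card (sym_diff (slice i b A) C) \<le> 2 * excess (S - {i}) (slice i b A)"
  shows "\<exists>C. subcube S C \<and> card (sym_diff A C) \<le> 2 * excess S A"
proof -
  define X Y where "X = slice i b A" and "Y = slice i (1 - b) A"
  note fin = finite_slice[OF S(1-3)]
  have card_A: "card A = card X + card Y" unfolding X_def Y_def by (rule card_slices[OF S])
  have "card A > 0" using \<open>A \<noteq> {}\<close> S finite_sub_vertices by (simp add: card_gt_0_iff)
  then have "card X > 0" using thin card_A unfolding Y_def[symmetric] by linarith
  then have "X \<noteq> {}" by auto
  have "excess (S - {i}) Y \<ge> 0" unfolding Y_def by (rule excess_slice_nonneg[OF S(1-3)])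
  moreover have "real (card X) - real (card Y) \<le> real (card (sym_diff X Y))"
    unfolding X_def Y_def by (rule card_diff_le_sym_diff[OF fin fin])
  moreover have "split_entropy (card X) (card Y) \<ge> 5 / 2 * card Y"
    by (rule split_entropy_unbalanced) (use thin card_A in \<open>auto simp: Y_def\<close>)
  ultimately have gain: "excess (S - {i}) X + card Y / 2 \<le> excess S A"
    using excess_slices[OF S] card_A unfolding X_def[symmetric] Y_def[symmetric] by simp
  then have "100 * excess (S - {i}) X \<le> card X" using small card_A by simp
  then obtain C' where C': "subcube (S - {i}) C'" "card (sym_diff X C') \<le> 2 * excess (S - {i}) X"
    using IH \<open>X \<noteq> {}\<close> unfolding X_def by blast
  obtain C where C: "subcube S C" "slice i b C = C'" "slice i (1 - b) C = {}"
    using subcube_lift_fixed[OF S(3,4) C'(1)] .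
  have "C \<subseteq> vertices S" using C(1) unfolding subcube_def by blast
  then have "card (sym_diff A C) = card (sym_diff X C') + card Y"
    using card_sym_diff_slices[OF S(1,2) _ S(3,4), of C]
    unfolding C(2,3) X_def[symmetric] Y_def[symmetric] by simp
  then have "card (sym_diff A C) \<le> 2 * excess S A" using C'(2) gain by simp
  then show ?thesis using C(1) by blast
qed

text \<open>
  This reaches only the constant 4, because a subcube near one slice has to serve for both. It is
  enough to exclude that the subcube fixes a coordinate: then a whole slice of \<open>A\<close>, more than a
  quarter of \<open>A\<close>, would lie outside it.
\<close>

lemma stability_step_balanced:
  assumes S: "finite S" "A \<subseteq> vertices S" "i \<in> S" "b = 0 \<or> b = 1"
    and small: "100 * excess S A \<le> card A"
    and thick: "\<And>j c. j \<in> S \<Longrightarrow> c = 0 \<or> c = 1 \<Longrightarrow> card A < 4 * card (slice j c A)"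
    and IH: "\<exists>C. subcube (S - {i}) C \<and> card (sym_diff (slice i b A) C) \<le> 2 * excess (S - {i}) (slice i b A)"
  shows "card (vertices S - A) \<le> 4 * excess S A"
proof -
  define X Y where "X = slice i b A" and "Y = slice i (1 - b) A"
  note fin = finite_slice[OF S(1-3)]
  have finX: "finite X" and finY: "finite Y" unfolding X_def Y_def by (rule fin)+
  have b': "1 - b = 0 \<or> 1 - b = 1" using S(4) by auto
  have card_A: "card A = card X + card Y" unfolding X_def Y_def by (rule card_slices[OF S])
  then have real_card_A: "real (card A) = real (card X) + real (card Y)" by simp
  have thick': "card A < 4 * card X" "card A < 4 * card Y"
    unfolding X_def Y_def by (rule thick[OF S(3,4)], rule thick[OF S(3) b'])
  have pos: "excess (S - {i}) X \<ge> 0" "excess (S - {i}) Y \<ge> 0"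
    unfolding X_def Y_def by (rule excess_slice_nonneg[OF S(1-3)])+
  have sum: "excess S A = excess (S - {i}) X + excess (S - {i}) Y + card (sym_diff X Y)
      + split_entropy (card X) (card Y) - card A"
    using excess_slices[OF S] unfolding X_def Y_def by simp
  \<comment> \<open>If \<open>m\<close> is the smaller of the two sizes, then \<open>|X \<Delta> Y| \<ge> |A| - 2 m \<ge> 2 (|A| - h)\<close>; so at least half
    of \<open>|X \<Delta> Y|\<close> survives in \<open>|X \<Delta> Y| + h - |A|\<close>.\<close>
  have XY: "card (sym_diff X Y) \<le> 2 * (excess S A - excess (S - {i}) X)"
  proof (cases "card Y \<le> card X")
    case True
    have "split_entropy (card X) (card Y) \<ge> real (card Y) + (real (card X) + real (card Y)) / 2"
      using True thick' card_A by (intro split_entropy_balanced) auto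
    then show ?thesis
      using card_diff_le_sym_diff[OF finX finY] sum pos(2) real_card_A by argo
  next
    case False
    have "split_entropy (card Y) (card X) \<ge> real (card X) + (real (card Y) + real (card X)) / 2"
      using False thick' card_A by (intro split_entropy_balanced) auto
    moreover have "real (card Y) - real (card X) \<le> card (sym_diff X Y)"
      using card_diff_le_sym_diff[OF finY finX] by (simp add: Un_commute)
    ultimately show ?thesis
      using sum pos(2) real_card_A split_entropy_commute[of "card X" "card Y"] by argo
  qed
  obtain I a where I: "I \<subseteq> S - {i}" "\<forall>k\<in>I. a k \<in> {0, 1}"
    and near: "card (sym_diff X {x \<in> vertices (S - {i}). \<forall>k\<in>I. x k = a k})
      \<le> 2 * excess (S - {i}) X"
    using IH unfolding subcube_def X_def by blast
  define C' C where "C' = {x \<in> vertices (S - {i}). \<forall>k\<in>I. x k = a k}"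
    and "C = {x \<in> vertices S. \<forall>k\<in>I. x k = a k}"
  have slice_C: "slice i b C = C'" "slice i (1 - b) C = C'"
    unfolding C_def C'_def
    by (rule subcube_lift_free[OF S(3) I(1) S(4)], rule subcube_lift_free[OF S(3) I(1) b'])
  have finC': "finite C'"
    by (rule finite_sub_vertices[of "S - {i}"]) (use S(1) in \<open>auto simp: C'_def\<close>)
  have "C \<subseteq> vertices S" unfolding C_def by blast
  then have "card (sym_diff A C) = card (sym_diff X C') + card (sym_diff Y C')"
    using card_sym_diff_slices[OF S(1,2) _ S(3,4), of C]
    unfolding slice_C X_def[symmetric] Y_def[symmetric] by simp
  moreover have "card (sym_diff Y C') \<le> card (sym_diff X Y) + card (sym_diff X C')"
    using card_sym_diff_triangle[OF finY finX finC'] by (simp add: Un_commute)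
  ultimately have near_A: "card (sym_diff A C) \<le> 4 * excess S A"
    using near[folded C'_def] XY pos(1) by simp
  have "I = {}"
  proof (rule ccontr)
    assume "I \<noteq> {}"
    then obtain j where j: "j \<in> I" by blast
    then have "j \<in> S" "a j = 0 \<or> a j = 1" using I by auto
    then have "card A < 4 * card (slice j (1 - a j) A)" by (intro thick) auto
    also have "card (slice j (1 - a j) A) = card {x \<in> A. x j = 1 - a j}" by (rule card_slice)
    also have "\<dots> \<le> card (sym_diff A C)"
    proof (rule card_mono)
      show "finite (sym_diff A C)"
        using finite_sub_vertices[OF S(1), of A] finite_sub_vertices[OF S(1), of C] S(2)
          \<open>C \<subseteq> vertices S\<close> by simp
      have "1 - a j \<noteq> a j" using \<open>a j = 0 \<or> a j = 1\<close> by auto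
      then show "{x \<in> A. x j = 1 - a j} \<subseteq> sym_diff A C" using j unfolding C_def by force
    qed
    finally have "real (card A) < 4 * real (card (sym_diff A C))" by linarith
    then show False using near_A small by simp
  qed
  then have "C = vertices S" by (simp add: C_def)
  moreover have "sym_diff A (vertices S) = vertices S - A" using S(2) by blast
  ultimately show ?thesis using near_A by simp
qed

text \<open>
  The bound is stated in terms of the excess itself, which is what the induction preserves; the
  constant 2 is the one for which the unbalanced step closes exactly.
\<close>

theorem edge_isoperimetric_stability:
  assumes "finite S" "A \<subseteq> vertices S" "A \<noteq> {}" "100 * excess S A \<le> card A"
  shows "\<exists>C. subcube S C \<and> card (sym_diff A C) \<le> 2 * excess S A"
  using assms
proof (induction "card S" arbitrary: S A rule: less_induct)
  case less
  note S = less.prems(1,2)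
  have IH: "\<exists>C. subcube (S - {i}) C \<and>
      card (sym_diff (slice i b A) C) \<le> 2 * excess (S - {i}) (slice i b A)"
    if "i \<in> S" "slice i b A \<noteq> {}" "100 * excess (S - {i}) (slice i b A) \<le> card (slice i b A)" for i b
    using less.hyps[OF card_Diff1_less[OF S(1) that(1)] _ slice_subset[OF S(2) that(1)] that(2,3)] S(1)
    by simp
  have nonneg: "excess S A \<ge> 0" by (rule edge_isoperimetric_inequality[OF S])
  consider (empty) "S = {}"
    | (thin) i b where "i \<in> S" "b = 0 \<or> b = 1" "4 * card (slice i (1 - b) A) \<le> card A"
    | (thick) "S \<noteq> {}"
      "\<And>i b. i \<in> S \<Longrightarrow> b = 0 \<or> b = 1 \<Longrightarrow> card A < 4 * card (slice i (1 - b) A)"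
    by (meson not_le)
  then show ?case
  proof cases
    case empty
    then have "A = vertices S" using S(2) less.prems(3) by auto
    then have "card (sym_diff A (vertices S)) = 0" by simp
    then show ?thesis using nonneg subcube_vertices[of S] by (intro exI[of _ "vertices S"]) simp
  next
    case thin
    show ?thesis
      by (rule stability_step_unbalanced[OF S thin(1,2) less.prems(3,4) thin(3) IH[OF thin(1)]])
  next
    case thick
    then obtain i where i: "i \<in> S" by blast
    have all_thick: "card A < 4 * card (slice j c A)" if "j \<in> S" "c = 0 \<or> c = 1" for j c
      using thick(2)[of j "1 - c"] that by auto
    have fin: "finite (slice i c A)" for c by (rule finite_slice[OF S i])
    have sum: "excess S A \<ge> excess (S - {i}) (slice i 0 A) + excess (S - {i}) (slice i 1 A)"
      using excess_slices[OF S i, of 0] card_slices[OF S i, of 0]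
        sym_diff_split_entropy[OF fin[of 0] fin[of 1]] by simp
    \<comment> \<open>Both the excess bound and the sizes add up over the slices, so one slice inherits the ratio.\<close>
    have "\<exists>b. (b = 0 \<or> b = 1) \<and> 100 * excess (S - {i}) (slice i b A) \<le> card (slice i b A)"
    proof (rule ccontr)
      assume "\<not> ?thesis"
      then have "\<not> 100 * excess (S - {i}) (slice i 0 A) \<le> card (slice i 0 A)"
        "\<not> 100 * excess (S - {i}) (slice i 1 A) \<le> card (slice i 1 A)" by blast+
      moreover have "card A = card (slice i 0 A) + card (slice i 1 A)"
        using card_slices[OF S i, of 0] by simp
      ultimately show False using sum less.prems(4) by linarith
    qed
    then obtain b where b: "b = 0 \<or> b = 1"
      "100 * excess (S - {i}) (slice i b A) \<le> card (slice i b A)" by blast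
    have "slice i b A \<noteq> {}" using all_thick[OF i b(1)] by auto
    then have "card (vertices S - A) \<le> 4 * excess S A"
      by (intro stability_step_balanced[OF S i b(1) less.prems(4) all_thick IH[OF i _ b(2)]])
    \<comment> \<open>The crude bound makes the complement small enough for the sharp one.\<close>
    then have "8 * real (card (vertices S - A)) \<le> card A" using less.prems(4) by simp
    then have "8 * card (vertices S - A) \<le> card A" by linarith
    also have "card A \<le> card (vertices S)" using S finite_vertices by (intro card_mono) auto
    finally have "8 * card (vertices S - A) \<le> 2 ^ card S" by (simp only: card_vertices[OF S(1)])
    then have "card (vertices S - A) \<le> excess S A" by (rule card_complement_le_excess[OF S])
    moreover have "sym_diff A (vertices S) = vertices S - A" using S(2) by blast
    ultimately have "card (sym_diff A (vertices S)) \<le> 2 * excess S A" using nonneg by simp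
    then show ?thesis using subcube_vertices by blast
  qed
qed

theorem theorem7:
  shows "\<exists>c::real. c > 0 \<and>
    (\<forall>(n::nat) (A :: (nat \<Rightarrow> nat) set) (\<epsilon>::real).
       n > 0 \<longrightarrow> A \<subseteq> cube n \<longrightarrow> A \<noteq> {} \<longrightarrow> 0 < \<epsilon> \<longrightarrow> \<epsilon> \<le> c \<longrightarrow>
       real (card (edge_boundary n A))
         \<le> real (card A) * log 2 (2 ^ n / real (card A)) + \<epsilon> * real (card A) \<longrightarrow>
       (\<exists>C. is_subcube n C \<and> real (card (sym_diff A C)) / real (card A) < 3 * \<epsilon>))"
proof (intro exI[of _ "1/100 :: real"] conjI allI impI)
  fix n :: nat and A :: "(nat \<Rightarrow> nat) set" and \<epsilon> :: real
  assume A: "A \<subseteq> cube n" "A \<noteq> {}" and \<epsilon>: "0 < \<epsilon>" "\<epsilon> \<le> 1/100"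
    and boundary: "real (card (edge_boundary n A))
      \<le> real (card A) * log 2 (2 ^ n / real (card A)) + \<epsilon> * real (card A)"
  have sub: "A \<subseteq> vertices {1..n}" using A(1) by (simp add: cube_def)
  have "finite A" by (rule finite_sub_vertices[OF _ sub]) simp
  then have pos: "real (card A) > 0" using A(2) by (simp add: card_gt_0_iff)
  have excess: "excess {1..n} A \<le> \<epsilon> * card A"
    using boundary by (simp add: excess_def card_edge_boundary[OF A(1)])
  also have "\<dots> \<le> 1/100 * card A" using \<epsilon> pos by (intro mult_right_mono) auto
  finally have "100 * excess {1..n} A \<le> card A" by simp
  then obtain C where C: "subcube {1..n} C" "card (sym_diff A C) \<le> 2 * excess {1..n} A"
    using edge_isoperimetric_stability[OF _ sub A(2)] by auto
  have "is_subcube n C" using C(1) unfolding subcube_def is_subcube_def cube_def .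
  moreover have "real (card (sym_diff A C)) < 3 * \<epsilon> * card A"
  proof -
    have "real (card (sym_diff A C)) \<le> 2 * (\<epsilon> * card A)" using C(2) excess by linarith
    also have "\<dots> < 3 * \<epsilon> * card A" using \<epsilon> pos by simp
    finally show ?thesis .
  qed
  ultimately show "\<exists>C. is_subcube n C \<and> real (card (sym_diff A C)) / real (card A) < 3 * \<epsilon>"
    using pos by (auto simp: divide_less_eq)
qed simp

end
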